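(* For all integers $i,j\ge 0$, $U(\kappa^i\xi^j)\in\mathbb{Z}[\xi]$; that is, $U(\kappa^i\xi^j)$ equals, as a formal power series in $q$, a polynomial in $\xi$ with integer coefficients.
   Context: Let $E(q)=\prod_{m\ge1}(1-q^m)$. Define $$\gamma(q)=\frac{E(q)^5E(q^2)^5E(q^6)^5}{E(q^3)^{15}},\qquad \xi=\xi(q)=\frac{E(q^2)^5E(q^6)}{E(q)E(q^3)^5},\qquad \kappa=\kappa(q)=\frac{\gamma(q^2)^2}{\gamma(q)}.$$ $U$ is the operator on power series given by $U\left(\sum_n a_nq^n\right)=\sum_n a_{2n}q^n$. *)

theory Defs
  imports "HOL-Computational_Algebra.Computational_Algebra"
begin

text \<open>Euler product E(q) = prod_{m>=1} (1 - q^m) as a formal power series over the rationals: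
  its n-th coefficient is the n-th coefficient of the finite product over m = 1..n
  (factors with m > n do not affect the coefficient of q^n).\<close>
definition E_fps :: "rat fps" where
  "E_fps = Abs_fps (\<lambda>n. fps_nth (\<Prod>m\<in>{1..n}. (1 - fps_X ^ m)) n)"

text \<open>Substitution q -> q^k (for k >= 1).\<close>
definition fps_dil :: "nat \<Rightarrow> rat fps \<Rightarrow> rat fps" where
  "fps_dil k f = Abs_fps (\<lambda>n. if k dvd n then fps_nth f (n div k) else 0)"

definition Eq :: "nat \<Rightarrow> rat fps" where
  "Eq k = fps_dil k E_fps"

definition gamma_at :: "nat \<Rightarrow> rat fps" where
  "gamma_at k = Eq k ^ 5 * Eq (2*k) ^ 5 * Eq (6*k) ^ 5 * inverse (Eq (3*k) ^ 15)"

definition xi_fps :: "rat fps" where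
  "xi_fps = Eq 2 ^ 5 * Eq 6 * inverse (Eq 1 * Eq 3 ^ 5)"

definition kappa_fps :: "rat fps" where
  "kappa_fps = gamma_at 2 ^ 2 * inverse (gamma_at 1)"

definition U_op :: "rat fps \<Rightarrow> rat fps" where
  "U_op f = Abs_fps (\<lambda>n. fps_nth f (2 * n))"

end

theory Submission
  imports Defs
begin

text \<open>
  Write $s = \xi(q^2)$, $E_k = E(q^k)$ and $w = E_2E_3^3E_4^2E_{12}^2/(E_1E_6^7)$. The 2-dissection of
  $E_3^3/E_1$ says that $w = s + o$ with $o = q E_2E_4E_{12}^5/E_6^7$, which is odd in $q$; it follows
  from $f(q,q^5)f(-q^3,-q^3) = f(-q^4,-q^8)^2 + q f(-q^2,-q^{10})^2$ for Ramanujan's theta function and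
  the Jacobi triple product. Let $z = w(-q) = s - o$. The product formula
  $E(-q) = E_2^3/(E_1E_4)$ gives $zw = s$, that is $o^2 = s^2 - s$. Replacing $q^2$ by $q$ in this
  relation yields $\xi = 3z - 2z^2$, and $\kappa = w^5$ is an identity of eta quotients. Hence
  $\kappa^i\xi^j = P(s) + R(s)o$ with integer polynomials $P, R$, and $U$ maps this to $P(\xi)$.
\<close>

section \<open>Gaussian binomials and the finite triple product\<close>

text \<open>Product identities are proved exactly for finite products and then read modulo q^N for
  every N, so no limits enter. Identities of eta quotients need division: they are stated over an
  arbitrary field, with \<open>e1\<close>, \<open>e2\<close>, ... in the place of E_1, E_2, ..., and
  applied in the field of Laurent series. The obstacle is that \<open>xi_fps\<close> is not a series
  in q^2, so U cannot be applied to its powers directly; it must be rewritten through s and o. Write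
  o = q rho(q^2). The relation o^2 = s^2 - s, read at q in place of q^2, is xi (xi - 1) = q rho^2.
  The factors E_4 and E_12 cancel in rho(q^2) z^3 / s^2, which leaves exactly rho^2 / xi. Hence xi -
  1 = o z^3 / s^2 with o = s - z. Since w = 2 s - z, the relation z w = s says z^2 = s (2 z - 1),
  and this reduces the right side to (1 - z)(2 z - 1).\<close>

fun qbinom :: "'a::comm_ring_1 \<Rightarrow> nat \<Rightarrow> nat \<Rightarrow> 'a" where
  "qbinom Q n 0 = 1"
| "qbinom Q 0 (Suc k) = 0"
| "qbinom Q (Suc n) (Suc k) = Q ^ (n - k) * qbinom Q n k + qbinom Q n (Suc k)"

lemma qbinom_eq_0: "n < k \<Longrightarrow> qbinom Q n k = 0"
  by (induction Q n k rule: qbinom.induct) auto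

text \<open>The mirror image of the defining q-Pascal rule under \<open>k\<close> to
  \<open>n - k\<close>. The triple product grows at both ends: its \<open>N\<close>-step uses the
  defining rule, its \<open>M\<close>-step this one. The induction expands both summands by the new
  rule and regroups them by the old one.\<close>

lemma qbinom_Suc_Suc':
  "qbinom Q (Suc n) (Suc k) = qbinom Q n k + Q ^ Suc k * qbinom Q n (Suc k)"
proof (induction n arbitrary: k)
  case 0
  show ?case by (cases k) auto
next
  case (Suc n)
  show ?case
  proof (cases k)
    case 0
    have "qbinom Q (Suc (Suc n)) (Suc 0) = Q ^ Suc n + qbinom Q (Suc n) (Suc 0)"
      by simp
    also have "\<dots> = Q ^ Suc n + (1 + Q * qbinom Q n (Suc 0))"
      by (simp only: Suc.IH) simp
    also have "\<dots> = 1 + Q * qbinom Q (Suc n) (Suc 0)"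
      by (simp add: algebra_simps)
    finally show ?thesis unfolding 0 by simp
  next
    case (Suc l)
    consider "l < n" | "l = n" | "l > n" by linarith
    thus ?thesis
    proof cases
      case 1
      then obtain m where n: "n = l + Suc m"
        using less_iff_Suc_add by auto
      have "qbinom Q (Suc (Suc n)) (Suc k)
              = Q ^ (Suc n - k) * qbinom Q (Suc n) (Suc l) + qbinom Q (Suc n) (Suc k)"
        by (simp add: Suc)
      also have "\<dots> = Q ^ (Suc n - k) * (qbinom Q n l + Q ^ k * qbinom Q n k)
                      + (qbinom Q n k + Q ^ Suc k * qbinom Q n (Suc k))"
        by (simp only: Suc.IH Suc)
      also have "\<dots> = (Q ^ (n - l) * qbinom Q n l + qbinom Q n k)
                      + Q ^ Suc k * (Q ^ (n - k) * qbinom Q n k + qbinom Q n (Suc k))"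
        by (simp add: Suc n algebra_simps power_add)
      also have "\<dots> = qbinom Q (Suc n) k + Q ^ Suc k * qbinom Q (Suc n) (Suc k)"
        by (simp add: Suc)
      finally show ?thesis .
    qed (auto simp: Suc qbinom_eq_0)
  qed
qed

definition qpoch :: "'a::comm_ring_1 \<Rightarrow> nat \<Rightarrow> 'a" where
  "qpoch Q n = (\<Prod>i<n. 1 - Q ^ Suc i)"

lemma qpoch_0 [simp]: "qpoch Q 0 = 1"
  and qpoch_Suc [simp]: "qpoch Q (Suc n) = qpoch Q n * (1 - Q ^ Suc n)"
  by (simp_all add: qpoch_def)

text \<open>The quotient formula for Gaussian binomials, with denominators cleared because the ring
  need not allow division.\<close>

lemma qbinom_qpoch: "k \<le> n \<Longrightarrow> qpoch Q k * qpoch Q (n - k) * qbinom Q n k = qpoch Q n"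
proof (induction Q n k rule: qbinom.induct)
  case (3 Q n k)
  have IH1: "qpoch Q k * qpoch Q (n - k) * qbinom Q n k = qpoch Q n"
    using 3 by auto
  show ?case
  proof (cases "k = n")
    case True
    have "qpoch Q n * qbinom Q n n = qpoch Q n" using IH1 True by simp
    hence "qpoch Q n * qbinom Q n n * (1 - Q ^ Suc n) = qpoch Q n * (1 - Q ^ Suc n)" by simp
    thus ?thesis using True by (simp add: qbinom_eq_0 mult_ac)
  next
    case False
    with 3 obtain m where n: "n = k + Suc m"
      using less_iff_Suc_add[of k n] by auto
    have IH2: "qpoch Q (Suc k) * qpoch Q m * qbinom Q n (Suc k) = qpoch Q n"
      using 3(2) n by auto
    \<comment> \<open>The two weights add up to the missing factor: \<open>(1 - Q ^ Suc k) * Q ^ Suc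
      m + (1 - Q ^ Suc m) = 1 - Q ^ Suc n\<close>, as \<open>n = k + Suc m\<close>.\<close>
    have "qpoch Q (Suc k) * qpoch Q (Suc n - Suc k) * qbinom Q (Suc n) (Suc k)
       = (1 - Q ^ Suc k) * Q ^ Suc m * (qpoch Q k * qpoch Q (n - k) * qbinom Q n k)
         + (1 - Q ^ Suc m) * (qpoch Q (Suc k) * qpoch Q m * qbinom Q n (Suc k))"
      by (simp add: n algebra_simps)
    also have "\<dots> = qpoch Q (Suc n)"
      unfolding IH1 IH2 by (simp add: n algebra_simps power_add)
    finally show ?thesis .
  qed
qed auto

lemma sum_shift_combine:
  fixes f g :: "nat \<Rightarrow> 'a::comm_ring_1"
  assumes "f (Suc n) = 0"
  shows "(\<Sum>j\<le>n. f j) + (\<Sum>j\<le>n. g j) = f 0 + (\<Sum>j\<le>n. g j + f (Suc j))"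
proof -
  have "(\<Sum>j\<le>n. f j) = (\<Sum>j\<le>Suc n. f j)" using assms by simp
  also have "\<dots> = f 0 + (\<Sum>j\<le>n. f (Suc j))" by (rule sum.atMost_Suc_shift)
  finally show ?thesis by (simp add: sum.distrib algebra_simps)
qed

text \<open>A two-sided form of the q-binomial theorem. The model for \<open>t k\<close> is x^k
  Q^(k(k-1)/2) with x y = Q; \<open>up\<close> and \<open>down\<close> encode its recurrence without
  negative powers or halves. When a factor is added, they leave the power \<open>Q ^ j\<close> (for
  \<open>M\<close>) or \<open>Q ^ (n - j)\<close> (for \<open>N\<close>), which is the weight in the
  matching Pascal rule.\<close>

lemma finite_triple_product:
  fixes t :: "int \<Rightarrow> 'a::comm_ring_1"
  assumes t0: "t 0 = 1"
    and up: "\<And>k N. k \<le> int N \<Longrightarrow> t k * (x * Q ^ N) = t (k + 1) * Q ^ nat (int N - k)"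
    and down: "\<And>l. t (- int l) * (y * Q ^ l) = t (- int (Suc l))"
  shows "(\<Prod>i<M. 1 + y * Q ^ i) * (\<Prod>i<N. 1 + x * Q ^ i)
           = (\<Sum>j\<le>M + N. qbinom Q (M + N) j * t (int j - int M))"
proof (induction N)
  case 0
  show ?case
  proof (induction M)
    case 0
    show ?case by (simp add: t0)
  next
    case (Suc M)
    have *: "t (int j - int M) * (y * Q ^ M) = t (int j - int (Suc M)) * Q ^ j" if "j \<le> M" for j
    proof -
      have "t (int j - int M) * (y * Q ^ M) = t (- int (M - j)) * (y * Q ^ (M - j)) * Q ^ j"
        using that by (simp add: mult.assoc flip: power_add)
      also have "t (- int (M - j)) * (y * Q ^ (M - j)) = t (int j - int (Suc M))"
        unfolding down using that by (simp add: Suc_diff_le algebra_simps)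
      finally show ?thesis .
    qed
    have "(\<Prod>i<Suc M. 1 + y * Q ^ i)
        = (\<Sum>j\<le>M. qbinom Q M j * (t (int j - int M) * (y * Q ^ M)))
          + (\<Sum>j\<le>M. qbinom Q M j * t (int j - int M))"
      using Suc by (simp add: algebra_simps sum_distrib_left sum.distrib)
    also have "(\<Sum>j\<le>M. qbinom Q M j * (t (int j - int M) * (y * Q ^ M)))
             = (\<Sum>j\<le>M. Q ^ j * qbinom Q M j * t (int j - int (Suc M)))"
    proof (intro sum.cong refl)
      fix j assume "j \<in> {..M}"
      thus "qbinom Q M j * (t (int j - int M) * (y * Q ^ M))
              = Q ^ j * qbinom Q M j * t (int j - int (Suc M))"
        by (subst *) (simp_all only: atMost_iff mult_ac)
    qed
    also have "\<dots> + (\<Sum>j\<le>M. qbinom Q M j * t (int j - int M))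
             = t (- int (Suc M)) + (\<Sum>j\<le>M. qbinom Q M j * t (int j - int M)
                 + Q ^ Suc j * qbinom Q M (Suc j) * t (int (Suc j) - int (Suc M)))"
      by (subst sum_shift_combine) (simp_all add: qbinom_eq_0)
    also have "\<dots> = (\<Sum>j\<le>Suc M. qbinom Q (Suc M) j * t (int j - int (Suc M)))"
      unfolding sum.atMost_Suc_shift[of _ M] qbinom_Suc_Suc'
      by (simp add: algebra_simps)
    finally show ?case by simp
  qed
next
  case (Suc N)
  define n where "n = M + N"
  have *: "t (int j - int M) * (x * Q ^ N) = t (int (Suc j) - int M) * Q ^ (n - j)" if "j \<le> n" for j
  proof -
    have "nat (int N - (int j - int M)) = n - j" "int j - int M + 1 = int (Suc j) - int M"
         "int j - int M \<le> int N"
      using that unfolding n_def by linarith+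
    thus ?thesis using up[of "int j - int M" N] by metis
  qed
  have "(\<Prod>i<M. 1 + y * Q ^ i) * (\<Prod>i<Suc N. 1 + x * Q ^ i)
      = (\<Sum>j\<le>n. qbinom Q n j * t (int j - int M)) * (1 + x * Q ^ N)"
    by (subst prod.lessThan_Suc) (simp only: Suc n_def flip: mult.assoc)
  also have "\<dots> = (\<Sum>j\<le>n. qbinom Q n j * t (int j - int M))
      + (\<Sum>j\<le>n. qbinom Q n j * (t (int j - int M) * (x * Q ^ N)))"
    by (simp add: algebra_simps sum_distrib_left sum.distrib)
  also have "(\<Sum>j\<le>n. qbinom Q n j * (t (int j - int M) * (x * Q ^ N)))
           = (\<Sum>j\<le>n. Q ^ (n - j) * qbinom Q n j * t (int (Suc j) - int M))"
  proof (intro sum.cong refl)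
    fix j assume "j \<in> {..n}"
    thus "qbinom Q n j * (t (int j - int M) * (x * Q ^ N))
            = Q ^ (n - j) * qbinom Q n j * t (int (Suc j) - int M)"
      by (subst *) (simp_all only: atMost_iff mult_ac)
  qed
  also have "(\<Sum>j\<le>n. qbinom Q n j * t (int j - int M)) + \<dots>
     = t (- int M) + (\<Sum>j\<le>n. Q ^ (n - j) * qbinom Q n j * t (int (Suc j) - int M)
                 + qbinom Q n (Suc j) * t (int (Suc j) - int M))"
    by (subst sum_shift_combine) (simp_all add: qbinom_eq_0)
  also have "\<dots> = (\<Sum>j\<le>Suc n. qbinom Q (Suc n) j * t (int j - int M))"
    unfolding sum.atMost_Suc_shift[of _ n] by (simp add: algebra_simps)
  finally show ?case by (simp add: n_def)
qed

section \<open>Euler products and theta series as formal power series\<close>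

text \<open>Congruence modulo q^N. Holding for all N it gives equality
  (\<open>fps_cong_eqI\<close>), so infinite products are met only through truncations.\<close>

definition fps_cong :: "nat \<Rightarrow> 'a::zero fps \<Rightarrow> 'a fps \<Rightarrow> bool" where
  "fps_cong N f g \<longleftrightarrow> (\<forall>i<N. fps_nth f i = fps_nth g i)"

lemma fps_cong_refl [simp]: "fps_cong N f f"
  by (simp add: fps_cong_def)

lemma fps_cong_sym: "fps_cong N f g \<Longrightarrow> fps_cong N g f"
  by (simp add: fps_cong_def)

lemma fps_cong_trans [trans]: "fps_cong N f g \<Longrightarrow> fps_cong N g h \<Longrightarrow> fps_cong N f h"
  by (simp add: fps_cong_def)

lemma fps_cong_eqI: "(\<And>N. fps_cong N f g) \<Longrightarrow> f = g"
  unfolding fps_cong_def fps_eq_iff by blast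

lemma fps_cong_mult:
  "fps_cong N f f' \<Longrightarrow> fps_cong N g g' \<Longrightarrow> fps_cong N (f * g) (f' * g')"
  unfolding fps_cong_def fps_mult_nth by (auto intro!: sum.cong)

lemma fps_cong_power:
  "fps_cong N f g \<Longrightarrow> fps_cong N (f ^ n) (g ^ n)"
  by (induction n) (auto intro: fps_cong_mult)

lemma fps_cong_sum:
  "(\<And>x. x \<in> A \<Longrightarrow> fps_cong N (f x) (g x)) \<Longrightarrow> fps_cong N (sum f A) (sum g A)"
  unfolding fps_cong_def by (auto simp: fps_sum_nth intro!: sum.cong)

lemma fps_cong_mult_cancel_left:
  fixes f g h :: "'a::field fps"
  assumes "fps_cong N (f * g) (f * h)" "fps_nth f 0 \<noteq> 0"
  shows "fps_cong N g h"
proof -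
  have "fps_cong N (inverse f * (f * g)) (inverse f * (f * h))"
    by (rule fps_cong_mult[OF fps_cong_refl assms(1)])
  thus ?thesis
    using inverse_mult_eq_1[OF assms(2)] by (simp only: mult.assoc [symmetric] mult_1_left)
qed

lemma qpoch_fps_X_power_nth_0 [simp]:
  "d > 0 \<Longrightarrow> fps_nth (qpoch (fps_X ^ d :: 'a::comm_ring_1 fps) n) 0 = 1"
  by (induction n) (simp_all flip: power_mult power_Suc)

text \<open>Each factor of index above \<open>m\<close> has the form 1 - q^e with e at least
  \<open>N\<close>.\<close>

lemma fps_cong_qpoch:
  assumes "d > 0" "N \<le> Suc m" "m \<le> n"
  shows "fps_cong N (qpoch (fps_X ^ d :: 'a::comm_ring_1 fps) n) (qpoch (fps_X ^ d) m)"
  using \<open>m \<le> n\<close>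
proof (induction n rule: dec_induct)
  case (step n)
  have "i < d * Suc n" if "i < N" for i
  proof -
    have "i < Suc n" using that assms(2) step.hyps(1) by linarith
    also have "Suc n \<le> d * Suc n" using assms(1) by (cases d) auto
    finally show ?thesis .
  qed
  hence "fps_cong N (1 - (fps_X ^ d) ^ Suc n) (1 :: 'a fps)"
    unfolding fps_cong_def power_mult [symmetric] by auto
  from fps_cong_mult[OF step.IH this] show ?case by simp
qed auto

lemma fps_dil_conv_compose: "k > 0 \<Longrightarrow> fps_dil k f = f oo fps_X ^ k"
  by (simp add: fps_eq_iff fps_dil_def fps_nth_compose_X_power)

lemma qpoch_compose:
  fixes c :: "'a::idom fps"
  assumes "fps_nth c 0 = 0"
  shows "qpoch Q n oo c = qpoch (Q oo c) n"
  by (induction n) (simp_all add: fps_compose_mult_distrib fps_compose_sub_distrib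
      fps_compose_power assms flip: power_Suc)

lemma fps_cong_compose:
  assumes "fps_cong N f g"  "fps_nth c 0 = 0"
  shows "fps_cong N (f oo c) (g oo c)"
  using assms unfolding fps_cong_def fps_compose_nth
  by (auto intro!: sum.cong)

lemma E_fps_nth: "fps_nth E_fps n = fps_nth (qpoch (fps_X ^ 1) n) n"
proof -
  have "(\<Prod>m\<in>{1..n}. 1 - fps_X ^ m) = (qpoch (fps_X ^ 1) n :: rat fps)"
    unfolding qpoch_def by (rule prod.reindex_bij_witness[of _ Suc "\<lambda>m. m - 1"]) auto
  thus ?thesis by (simp add: E_fps_def)
qed

lemma fps_cong_E:
  assumes "N \<le> Suc n"
  shows "fps_cong N E_fps (qpoch (fps_X ^ 1) n)"
  unfolding fps_cong_def
proof (intro allI impI)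
  fix i assume "i < N"
  thus "fps_nth E_fps i = fps_nth (qpoch (fps_X ^ 1) n) i"
    using fps_cong_qpoch[of 1 "Suc i" i n, where 'a = rat] assms
    unfolding fps_cong_def E_fps_nth by auto
qed

lemma fps_cong_Eq:
  assumes "d > 0" "N \<le> Suc n"
  shows "fps_cong N (Eq d) (qpoch (fps_X ^ d) n)"
proof -
  have "fps_cong N (E_fps oo fps_X ^ d) (qpoch (fps_X ^ 1) n oo fps_X ^ d)"
    using assms by (intro fps_cong_compose fps_cong_E) auto
  thus ?thesis
    using assms by (simp add: Eq_def fps_dil_conv_compose qpoch_compose)
qed

lemma Eq_nth_0: "d > 0 \<Longrightarrow> fps_nth (Eq d) 0 = 1"
  using fps_cong_Eq[of d 1 0] by (simp add: fps_cong_def)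

text \<open>For 0 < a < 2h the integer under \<open>nat\<close> is never negative, so nothing is
  truncated. Writing \<open>h\<close> for half the modulus avoids dividing k(k-1) by 2; the price is
  that the modulus \<open>2 * h\<close> is always even.\<close>

definition theta_exp :: "nat \<Rightarrow> nat \<Rightarrow> int \<Rightarrow> nat" where
  "theta_exp h a k = nat (int h * (k * (k - 1)) + int a * k)"

definition sign_pow :: "int \<Rightarrow> 'a::ring_1" where
  "sign_pow k = (if even k then 1 else -1)"

text \<open>The series $\sum_{k\in\mathbb{Z}} (-1)^k q^{hk(k-1)+ak}$, which is Ramanujan's
  $f(-q^a,-q^{2h-a})$.\<close>

definition theta :: "nat \<Rightarrow> nat \<Rightarrow> rat fps" where
  "theta h a = Abs_fps (\<lambda>n. \<Sum>k | theta_exp h a k = n. sign_pow k)"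

context
  fixes h a b :: nat
  assumes ab: "a > 0" "b > 0" "a + b = 2 * h"
begin

text \<open>The bound makes the fibres finite, without which the coefficient sums of
  \<open>theta\<close> would default to 0. Negative \<open>k\<close> reduces to positive
  \<open>k\<close> because \<open>k\<close> to \<open>-k\<close> exchanges \<open>a\<close> and
  \<open>b\<close>.\<close>

lemma theta_exp_int:
  "int (theta_exp h a k) = int h * (k * (k - 1)) + int a * k" (is ?th1)
  and theta_exp_ge: "\<bar>k\<bar> \<le> int (theta_exp h a k)" (is ?th2)
proof -
  have "\<bar>k\<bar> \<le> int h * (k * (k - 1)) + int a * k"
  proof (cases "k \<ge> 0")
    case True
    have "0 \<le> k * (k - 1)" using True by (cases "k = 0") auto
    hence "0 \<le> int h * (k * (k - 1))" by simp
    moreover have "1 * k \<le> int a * k" using True ab by (intro mult_right_mono) auto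
    ultimately show ?thesis using True by simp
  next
    case False
    define l where "l = - k"
    have "l > 0" using False by (simp add: l_def)
    have eq: "int a = 2 * int h - int b" using ab by simp
    have "int h * (k * (k - 1)) + int a * k = int h * (l * (l - 1)) + int b * l"
      by (simp add: eq l_def algebra_simps)
    moreover have "0 \<le> int h * (l * (l - 1))" using \<open>l > 0\<close> by simp
    moreover have "1 * l \<le> int b * l" using \<open>l > 0\<close> ab by (intro mult_right_mono) auto
    ultimately have "l \<le> int h * (k * (k - 1)) + int a * k" by linarith
    thus ?thesis using False by (simp add: l_def)
  qed
  thus ?th1 ?th2 by (auto simp: theta_exp_def)
qed

lemma finite_theta_exp: "finite {k. theta_exp h a k = n}"
proof (rule finite_subset)
  show "{k. theta_exp h a k = n} \<subseteq> {- int n..int n}"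
  proof
    fix k assume "k \<in> {k. theta_exp h a k = n}"
    thus "k \<in> {- int n..int n}" using theta_exp_ge[of k] by (auto simp: abs_le_iff)
  qed
qed auto

text \<open>The Jacobi triple product modulo q^N. After multiplication by \<open>qpoch Q n\<close>,
  the coefficients of the finite version become 1 modulo q^N for |k| < N, and the remaining terms
  vanish since their exponent is at least |k|. The bound \<open>2 * N \<le> n\<close> keeps both
  lower indices n + k and n - k at least N.\<close>

lemma fps_cong_theta:
  assumes n: "2 * N \<le> n"
  shows "fps_cong N (theta h a) (qpoch (fps_X ^ (2 * h)) n *
           ((\<Prod>i<n. 1 - fps_X ^ (b + 2 * h * i)) * (\<Prod>i<n. 1 - fps_X ^ (a + 2 * h * i))))"
proof -
  define Q :: "rat fps" where "Q = fps_X ^ (2 * h)"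
  define t :: "int \<Rightarrow> rat fps" where "t k = sign_pow k * fps_X ^ theta_exp h a k" for k
  have h: "h > 0" using ab by simp
  have t_nth: "fps_nth (t k) i = (if theta_exp h a k = i then sign_pow k else 0)" for k i
    by (auto simp: t_def sign_pow_def)
  \<comment> \<open>The instance is x = -q^a, y = -q^b, so that x y = q^(a+b) = q^(2h) = Q.\<close>
  have up: "t k * (- (fps_X ^ a) * Q ^ N) = t (k + 1) * Q ^ nat (int N - k)"
    if "k \<le> int N" for k N
  proof -
    have "int (theta_exp h a k + a + 2 * h * N)
            = int (theta_exp h a (k + 1) + 2 * h * nat (int N - k))"
      using that by (simp add: theta_exp_int algebra_simps)
    hence "fps_X ^ (theta_exp h a k + a + 2 * h * N)
            = (fps_X ^ (theta_exp h a (k + 1) + 2 * h * nat (int N - k)) :: rat fps)"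
      by (metis of_nat_eq_iff)
    thus ?thesis
      by (simp add: t_def Q_def sign_pow_def power_add power_mult mult.assoc)
  qed
  have down: "t (- int l) * (- (fps_X ^ b) * Q ^ l) = t (- int (Suc l))" for l
  proof -
    have eq: "int a = 2 * int h - int b" using ab by simp
    have "int (theta_exp h a (- int l) + b + 2 * h * l) = int (theta_exp h a (- int (Suc l)))"
      by (simp add: theta_exp_int eq algebra_simps)
    hence "fps_X ^ (theta_exp h a (- int l) + b + 2 * h * l)
            = (fps_X ^ theta_exp h a (- int (Suc l)) :: rat fps)"
      by (metis of_nat_eq_iff)
    thus ?thesis
      by (simp add: t_def Q_def sign_pow_def power_add power_mult mult.assoc)
  qed
  have t0: "t 0 = 1"
    by (simp add: t_def sign_pow_def theta_exp_def)

  have "qpoch Q n * ((\<Prod>i<n. 1 - fps_X ^ (b + 2 * h * i)) * (\<Prod>i<n. 1 - fps_X ^ (a + 2 * h * i)))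
      = qpoch Q n * ((\<Prod>i<n. 1 + (- (fps_X ^ b)) * Q ^ i) * (\<Prod>i<n. 1 + (- (fps_X ^ a)) * Q ^ i))"
    by (simp add: Q_def power_add power_mult)
  also have "\<dots> = (\<Sum>j\<le>n + n. qpoch Q n * qbinom Q (n + n) j * t (int j - int n))"
    by (subst finite_triple_product[OF t0 up down]) (auto simp: sum_distrib_left mult.assoc)
  also have "\<dots> = (\<Sum>k\<in>{-int n..int n}. qpoch Q n * qbinom Q (n + n) (nat (k + int n)) * t k)"
    by (rule sum.reindex_bij_witness[of _ "\<lambda>k. nat (k + int n)" "\<lambda>j. int j - int n"]) auto
  finally have eq: "qpoch Q n * ((\<Prod>i<n. 1 - fps_X ^ (b + 2 * h * i)) * (\<Prod>i<n. 1 - fps_X ^ (a + 2 * h * i)))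
      = (\<Sum>k\<in>{-int n..int n}. qpoch Q n * qbinom Q (n + n) (nat (k + int n)) * t k)" .
  have "fps_cong N (\<Sum>k\<in>{-int n..int n}. qpoch Q n * qbinom Q (n + n) (nat (k + int n)) * t k)
          (\<Sum>k\<in>{-int n..int n}. 1 * t k)"
  proof (rule fps_cong_sum)
    fix k assume k: "k \<in> {- int n..int n}"
    show "fps_cong N (qpoch Q n * qbinom Q (n + n) (nat (k + int n)) * t k) (1 * t k)"
    proof (cases "\<bar>k\<bar> < int N")
      case True
      define j where "j = nat (k + int n)"
      have j: "N \<le> j" "N \<le> n + n - j" "j \<le> n + n" using True n by (auto simp: j_def)
      have P: "fps_cong N (qpoch Q r) (qpoch Q N)" if "N \<le> r" for r
        unfolding Q_def using h that by (intro fps_cong_qpoch) auto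
      have P': "fps_cong N (qpoch Q r) (qpoch Q r')" if "N \<le> r" "N \<le> r'" for r r'
        using fps_cong_trans[OF P fps_cong_sym[OF P]] that by blast
      \<comment> \<open>A second factor \<open>qpoch Q n\<close> is inserted so that the pair can be
        traded for the two denominators of the Gaussian binomial: all \<open>qpoch Q r\<close> with
        r at least N agree modulo q^N. It is cancelled afterwards.\<close>
      have "fps_cong N (qpoch Q n * (qpoch Q n * qbinom Q (n + n) j))
              (qpoch Q j * (qpoch Q (n + n - j) * qbinom Q (n + n) j))"
        using j n by (intro fps_cong_mult P') auto
      also have "\<dots> = qpoch Q (n + n)"
        using qbinom_qpoch[OF j(3), of Q] by (simp only: mult.assoc)
      also have "fps_cong N \<dots> (qpoch Q n * 1)"
        using n P'[of "n + n" n] by simp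
      finally have "fps_cong N (qpoch Q n * (qpoch Q n * qbinom Q (n + n) j)) (qpoch Q n * 1)" .
      hence "fps_cong N (qpoch Q n * qbinom Q (n + n) j) 1"
        by (rule fps_cong_mult_cancel_left) (use h in \<open>auto simp: Q_def\<close>)
      thus ?thesis unfolding j_def by (rule fps_cong_mult) simp
    next
      case False
      have "N \<le> theta_exp h a k" using theta_exp_ge[of k] False by linarith
      hence "fps_cong N (t k) 0" by (auto simp: fps_cong_def t_nth)
      hence "fps_cong N (f * t k) 0" for f
        using fps_cong_mult[of N f f "t k" 0] by simp
      thus ?thesis by (metis fps_cong_sym fps_cong_trans)
    qed
  qed
  also have "fps_cong N (\<Sum>k\<in>{-int n..int n}. 1 * t k) (theta h a)"
    unfolding fps_cong_def
  proof (intro allI impI)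
    fix i assume i: "i < N"
    have "fps_nth (\<Sum>k\<in>{-int n..int n}. 1 * t k) i
            = (\<Sum>k\<in>{-int n..int n}. if theta_exp h a k = i then sign_pow k else 0)"
      by (simp add: fps_sum_nth t_nth)
    also have "\<dots> = (\<Sum>k | k \<in> {-int n..int n} \<and> theta_exp h a k = i. sign_pow k)"
      by (rule sum.inter_filter [symmetric]) auto
    also have "{k. k \<in> {-int n..int n} \<and> theta_exp h a k = i} = {k. theta_exp h a k = i}"
    proof -
      have "k \<in> {-int n..int n}" if "theta_exp h a k = i" for k
        using theta_exp_ge[of k] that i n by auto
      thus ?thesis by blast
    qed
    finally show "fps_nth (\<Sum>k\<in>{-int n..int n}. 1 * t k) i = fps_nth (theta h a) i"
      by (simp add: theta_def)
  qed
  finally have "fps_cong N (qpoch Q n * ((\<Prod>i<n. 1 - fps_X ^ (b + 2 * h * i)) *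
      (\<Prod>i<n. 1 - fps_X ^ (a + 2 * h * i)))) (theta h a)"
    unfolding eq .
  thus ?thesis unfolding Q_def by (rule fps_cong_sym)
qed

end

section \<open>Product evaluations\<close>

text \<open>Sorting the exponents by residue modulo 3. The lengths match exactly, so the finite
  identity has no error term; the same holds for the next three lemmas.\<close>

lemma qpoch_split_3:
  "qpoch (x ^ 3) n * ((\<Prod>i<n. 1 - x ^ (2 + 3 * i)) * (\<Prod>i<n. 1 - x ^ (1 + 3 * i))) = qpoch x (3 * n)"
proof (induction n)
  case (Suc n)
  have e: "3 * Suc n = Suc (Suc (Suc (3 * n)))" by simp
  have "qpoch (x ^ 3) (Suc n) * ((\<Prod>i<Suc n. 1 - x ^ (2 + 3 * i)) * (\<Prod>i<Suc n. 1 - x ^ (1 + 3 * i)))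
    = (qpoch (x ^ 3) n * ((\<Prod>i<n. 1 - x ^ (2 + 3 * i)) * (\<Prod>i<n. 1 - x ^ (1 + 3 * i)))) *
      ((1 - (x ^ 3) ^ Suc n) * ((1 - x ^ (2 + 3 * n)) * (1 - x ^ (1 + 3 * n))))"
    by (simp only: qpoch_Suc prod.lessThan_Suc mult_ac)
  also have "\<dots> = qpoch x (3 * Suc n)"
    unfolding Suc e qpoch_Suc power_mult [symmetric] by (simp add: mult_ac)
  finally show ?case .
qed auto

lemma qpoch_split_2:
  "qpoch (x ^ 2) n * ((\<Prod>i<n. 1 - x ^ (1 + 2 * i)) * (\<Prod>i<n. 1 - x ^ (1 + 2 * i))) * qpoch (x ^ 2) n
     = qpoch x (2 * n) ^ 2"
proof (induction n)
  case (Suc n)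
  have e: "2 * Suc n = Suc (Suc (2 * n))" by simp
  have "qpoch (x ^ 2) (Suc n) * ((\<Prod>i<Suc n. 1 - x ^ (1 + 2 * i)) * (\<Prod>i<Suc n. 1 - x ^ (1 + 2 * i)))
      * qpoch (x ^ 2) (Suc n)
    = (qpoch (x ^ 2) n * ((\<Prod>i<n. 1 - x ^ (1 + 2 * i)) * (\<Prod>i<n. 1 - x ^ (1 + 2 * i))) * qpoch (x ^ 2) n)
      * (((1 - (x ^ 2) ^ Suc n) * (1 - x ^ (1 + 2 * n))) * ((1 - (x ^ 2) ^ Suc n) * (1 - x ^ (1 + 2 * n))))"
    by (simp only: qpoch_Suc prod.lessThan_Suc mult_ac)
  also have "\<dots> = qpoch x (2 * Suc n) ^ 2"
    unfolding Suc e qpoch_Suc power_mult [symmetric] by (simp add: mult_ac power2_eq_square)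
  finally show ?case .
qed auto

text \<open>Inclusion-exclusion: the exponents prime to 6 are those in residues 1 and 5, while
  multiples of 6 are counted among both the multiples of 2 and those of 3.\<close>

lemma qpoch_split_6:
  "qpoch (x ^ 6) n * ((\<Prod>i<n. 1 - x ^ (5 + 6 * i)) * (\<Prod>i<n. 1 - x ^ (1 + 6 * i))) *
     (qpoch (x ^ 2) (3 * n) * qpoch (x ^ 3) (2 * n))
     = qpoch x (6 * n) * qpoch (x ^ 6) n ^ 2"
proof (induction n)
  case (Suc n)
  have e: "6 * Suc n = Suc (Suc (Suc (Suc (Suc (Suc (6 * n))))))"
    "2 * Suc n = Suc (Suc (2 * n))" "3 * Suc n = Suc (Suc (Suc (3 * n)))" by simp_all
  have ee: "5 + 6 * n = Suc (Suc (Suc (Suc (Suc (6 * n)))))"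
    "1 + 6 * n = Suc (6 * n)"
    "6 * Suc n = Suc (Suc (Suc (Suc (Suc (Suc (6 * n))))))"
    "2 * Suc (3 * n) = Suc (Suc (6 * n))"
    "2 * Suc (Suc (3 * n)) = Suc (Suc (Suc (Suc (6 * n))))"
    "2 * Suc (Suc (Suc (3 * n))) = Suc (Suc (Suc (Suc (Suc (Suc (6 * n))))))"
    "3 * Suc (2 * n) = Suc (Suc (Suc (6 * n)))"
    "3 * Suc (Suc (2 * n)) = Suc (Suc (Suc (Suc (Suc (Suc (6 * n))))))" by simp_all
  have "qpoch (x ^ 6) (Suc n) * ((\<Prod>i<Suc n. 1 - x ^ (5 + 6 * i)) * (\<Prod>i<Suc n. 1 - x ^ (1 + 6 * i))) *
     (qpoch (x ^ 2) (3 * Suc n) * qpoch (x ^ 3) (2 * Suc n))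
   = (qpoch (x ^ 6) n * ((\<Prod>i<n. 1 - x ^ (5 + 6 * i)) * (\<Prod>i<n. 1 - x ^ (1 + 6 * i))) *
     (qpoch (x ^ 2) (3 * n) * qpoch (x ^ 3) (2 * n))) *
     ((1 - (x ^ 6) ^ Suc n) * (1 - x ^ (5 + 6 * n)) * (1 - x ^ (1 + 6 * n)) *
      ((1 - (x ^ 2) ^ Suc (3 * n)) * (1 - (x ^ 2) ^ Suc (Suc (3 * n))) * (1 - (x ^ 2) ^ Suc (Suc (Suc (3 * n))))
      * ((1 - (x ^ 3) ^ Suc (2 * n)) * (1 - (x ^ 3) ^ Suc (Suc (2 * n))))))"
    unfolding e qpoch_Suc prod.lessThan_Suc by (simp only: mult_ac)
  also have "\<dots> = qpoch x (6 * Suc n) * qpoch (x ^ 6) (Suc n) ^ 2"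
    unfolding Suc e qpoch_Suc power_mult [symmetric] ee by (simp only: mult_ac power2_eq_square)
  finally show ?case .
qed auto

text \<open>Odd exponents m pair up as (1 + x^m)(1 - x^m) = 1 - x^(2m), even ones give squares;
  \<open>qpoch (x ^ 4) n\<close> supplies the even-indexed factors missing from
  \<open>qpoch (x ^ 2) (2 * n)\<close>.\<close>

lemma qpoch_uminus:
  "qpoch (- x) (2 * n) * qpoch x (2 * n) * qpoch (x ^ 4) n
     = qpoch (x ^ 2) n ^ 2 * qpoch (x ^ 2) (2 * n)"
proof (induction n)
  case (Suc n)
  have e: "2 * Suc n = Suc (Suc (2 * n))" by simp
  have "qpoch (- x) (2 * Suc n) * qpoch x (2 * Suc n) * qpoch (x ^ 4) (Suc n)
    = (qpoch (- x) (2 * n) * qpoch x (2 * n) * qpoch (x ^ 4) n) *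
      ((1 - (- x) ^ Suc (2 * n)) * (1 - x ^ Suc (2 * n)) *
       ((1 - (- x) ^ Suc (Suc (2 * n))) * (1 - x ^ Suc (Suc (2 * n)))) * (1 - (x ^ 4) ^ Suc n))"
    unfolding e qpoch_Suc by (simp only: mult_ac)
  also have "(1 - (- x) ^ Suc (2 * n)) * (1 - x ^ Suc (2 * n)) = 1 - (x ^ 2) ^ Suc (2 * n)"
  proof -
    have "(x ^ 2) ^ Suc (2 * n) = x ^ Suc (2 * n) * x ^ Suc (2 * n)"
      by (metis power2_eq_square power_mult mult.commute)
    moreover have "(- x) ^ Suc (2 * n) = - (x ^ Suc (2 * n))"
      by (rule power_minus_odd) simp
    ultimately show ?thesis by (simp only: algebra_simps) simp
  qed
  also have "(1 - (- x) ^ Suc (Suc (2 * n))) * (1 - x ^ Suc (Suc (2 * n))) = (1 - (x ^ 2) ^ Suc n) ^ 2"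
    by (simp add: power_mult power2_eq_square mult.assoc)
  also have "(x ^ 4) ^ Suc n = (x ^ 2) ^ Suc (Suc (2 * n))"
    by (simp flip: power_mult)
  finally show ?case
    unfolding Suc e qpoch_Suc by (simp only: mult_ac power2_eq_square)
qed auto

text \<open>Euler's pentagonal number theorem; \<open>d\<close> is even so that the modulus 3d has
  the form 2h.\<close>

lemma theta_1_3:
  assumes "even d" "d > 0"
  shows "theta (3 * d div 2) d = Eq d"
proof (rule fps_cong_eqI)
  fix N :: nat
  have d: "2 * (3 * d div 2) = 3 * d" using assms by auto
  let ?n = "2 * N"
  have "fps_cong N (theta (3 * d div 2) d) (qpoch (fps_X ^ (3 * d)) ?n *
           ((\<Prod>i<?n. 1 - fps_X ^ (2 * d + 3 * d * i)) * (\<Prod>i<?n. 1 - fps_X ^ (d + 3 * d * i))))"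
    using fps_cong_theta[of d "2 * d" "3 * d div 2" N ?n] assms unfolding d by simp
  also have "\<dots> = qpoch (fps_X ^ d) (3 * ?n)"
    using qpoch_split_3[of "fps_X ^ d :: rat fps" ?n]
    by (simp add: mult_ac power_add del: add_2_eq_Suc add_2_eq_Suc' flip: power_mult)
  also have "fps_cong N \<dots> (Eq d)"
    using assms by (intro fps_cong_sym[OF fps_cong_Eq]) auto
  finally show "fps_cong N (theta (3 * d div 2) d) (Eq d)" .
qed

lemma theta_1_2:
  assumes "d > 0"
  shows "theta d d * Eq (2 * d) = Eq d ^ 2"
proof (rule fps_cong_eqI)
  fix N :: nat
  let ?n = "2 * N"
  have "fps_cong N (theta d d * Eq (2 * d)) (qpoch (fps_X ^ (2 * d)) ?n *
           ((\<Prod>i<?n. 1 - fps_X ^ (d + 2 * d * i)) * (\<Prod>i<?n. 1 - fps_X ^ (d + 2 * d * i)))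
           * qpoch (fps_X ^ (2 * d)) ?n)"
    using assms by (intro fps_cong_mult fps_cong_theta fps_cong_Eq) auto
  also have "\<dots> = qpoch (fps_X ^ d) (2 * ?n) ^ 2"
    using qpoch_split_2[of "fps_X ^ d :: rat fps" ?n]
    by (simp add: mult_ac power_add del: add_2_eq_Suc add_2_eq_Suc' flip: power_mult)
  also have "fps_cong N \<dots> (Eq d ^ 2)"
    using assms by (intro fps_cong_sym[OF fps_cong_power] fps_cong_Eq) auto
  finally show "fps_cong N (theta d d * Eq (2 * d)) (Eq d ^ 2)" .
qed

lemma theta_1_6:
  assumes "d > 0"
  shows "theta (3 * d) d * (Eq (2 * d) * Eq (3 * d)) = Eq d * Eq (6 * d) ^ 2"
proof (rule fps_cong_eqI)
  fix N :: nat
  let ?n = "2 * N"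
  have "fps_cong N (theta (3 * d) d * (Eq (2 * d) * Eq (3 * d)))
          (qpoch (fps_X ^ (2 * (3 * d))) ?n *
           ((\<Prod>i<?n. 1 - fps_X ^ (5 * d + 2 * (3 * d) * i)) * (\<Prod>i<?n. 1 - fps_X ^ (d + 2 * (3 * d) * i)))
           * (qpoch (fps_X ^ (2 * d)) (3 * ?n) * qpoch (fps_X ^ (3 * d)) (2 * ?n)))"
    using assms by (intro fps_cong_mult fps_cong_theta fps_cong_Eq) auto
  also have "\<dots> = qpoch (fps_X ^ d) (6 * ?n) * qpoch (fps_X ^ (6 * d)) ?n ^ 2"
    using qpoch_split_6[of "fps_X ^ d :: rat fps" ?n]
    by (simp add: mult_ac power_add del: add_2_eq_Suc add_2_eq_Suc' flip: power_mult)
  also have "fps_cong N \<dots> (Eq d * Eq (6 * d) ^ 2)"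
    using assms by (intro fps_cong_sym[OF fps_cong_mult] fps_cong_power fps_cong_Eq) auto
  finally show "fps_cong N (theta (3 * d) d * (Eq (2 * d) * Eq (3 * d))) (Eq d * Eq (6 * d) ^ 2)" .
qed

text \<open>Oddness of \<open>d\<close> is what turns q^d into -q^d under q to -q.\<close>

lemma Eq_uminus:
  assumes "odd d"
  shows "(Eq d oo (-fps_X)) * Eq d * Eq (4 * d) = Eq (2 * d) ^ 3"
proof (rule fps_cong_eqI)
  fix N :: nat
  have d: "d > 0" using assms by (cases d) auto
  have "fps_cong N (Eq d oo (-fps_X)) (qpoch (fps_X ^ d) (2 * N) oo (-fps_X))"
    using d by (intro fps_cong_compose fps_cong_Eq) auto
  also have "qpoch (fps_X ^ d) (2 * N) oo (-fps_X) = qpoch (- (fps_X ^ d) :: rat fps) (2 * N)"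
    using assms by (simp add: qpoch_compose fps_compose_power [symmetric])
  finally have "fps_cong N ((Eq d oo (-fps_X)) * Eq d * Eq (4 * d))
     (qpoch (- (fps_X ^ d)) (2 * N) * qpoch (fps_X ^ d) (2 * N) * qpoch (fps_X ^ (4 * d)) N)"
    using d by (intro fps_cong_mult fps_cong_Eq) auto
  also have "\<dots> = qpoch (fps_X ^ (2 * d)) N ^ 2 * qpoch (fps_X ^ (2 * d)) (2 * N)"
    using qpoch_uminus[of "fps_X ^ d :: rat fps" N]
    by (simp add: mult_ac flip: power_mult)
  also have "fps_cong N \<dots> (Eq (2 * d) ^ 2 * Eq (2 * d))"
    using d by (intro fps_cong_sym[OF fps_cong_mult] fps_cong_power fps_cong_Eq) auto
  also have "\<dots> = Eq (2 * d) ^ 3"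
    by (simp add: power3_eq_cube power2_eq_square)
  finally show "fps_cong N ((Eq d oo (-fps_X)) * Eq d * Eq (4 * d)) (Eq (2 * d) ^ 3)" .
qed

section \<open>The theta product identity\<close>

text \<open>Generating function of an arbitrary index set, so that a product of two theta series
  becomes a single sum over integer pairs that can be reindexed. It is meaningful only for finite
  fibres.\<close>

definition weight_gf :: "('i \<Rightarrow> nat) \<Rightarrow> ('i \<Rightarrow> 'a::comm_ring_1) \<Rightarrow> 'a fps" where
  "weight_gf e s = Abs_fps (\<lambda>n. \<Sum>i | e i = n. s i)"

lemma weight_gf_mult:
  fixes e1 :: "'i \<Rightarrow> nat" and e2 :: "'j \<Rightarrow> nat"
  assumes "\<And>n. finite {i. e1 i = n}" "\<And>n. finite {i. e2 i = n}"
  shows "weight_gf e1 s1 * weight_gf e2 s2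
           = weight_gf (\<lambda>(i, j). e1 i + e2 j) (\<lambda>(i, j). s1 i * s2 j)"
proof (rule fps_ext)
  fix n
  let ?A = "\<lambda>m. {i. e1 i = m} \<times> {j. e2 j = n - m}"
  have "fps_nth (weight_gf e1 s1 * weight_gf e2 s2) n
      = (\<Sum>m=0..n. \<Sum>(i, j)\<in>?A m. s1 i * s2 j)"
    by (simp add: weight_gf_def fps_mult_nth sum_product sum.cartesian_product)
  also have "\<dots> = (\<Sum>(i, j)\<in>(\<Union>m\<in>{0..n}. ?A m). s1 i * s2 j)"
    by (rule sum.UNION_disjoint [symmetric]) (auto intro!: finite_cartesian_product assms)
  also have "(\<Union>m\<in>{0..n}. ?A m) = {(i, j). e1 i + e2 j = n}"
    by auto
  finally show "fps_nth (weight_gf e1 s1 * weight_gf e2 s2) n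
      = fps_nth (weight_gf (\<lambda>(i, j). e1 i + e2 j) (\<lambda>(i, j). s1 i * s2 j)) n"
    by (simp add: weight_gf_def case_prod_unfold)
qed

lemma finite_weight_fibre_pair:
  fixes e1 :: "'i \<Rightarrow> nat" and e2 :: "'j \<Rightarrow> nat"
  assumes "\<And>n. finite {i. e1 i = n}" "\<And>n. finite {i. e2 i = n}"
  shows "finite {(i, j). e1 i + e2 j = n}"
proof (rule finite_subset)
  show "{(i, j). e1 i + e2 j = n} \<subseteq> (\<Union>m\<in>{0..n}. {i. e1 i = m} \<times> {j. e2 j = n - m})"
    by auto
qed (auto intro!: finite_cartesian_product assms)

lemma theta_conv_weight_gf: "theta h a = weight_gf (theta_exp h a) sign_pow"
  by (simp add: theta_def weight_gf_def)

lemma finite_theta_exp':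
  assumes "0 < a" "a < 2 * h"
  shows "finite {k. theta_exp h a k = n}"
  by (rule finite_theta_exp[of a "2 * h - a"]) (use assms in auto)

lemma theta_exp_int':
  assumes "0 < a" "a < 2 * h"
  shows "int (theta_exp h a k) = int h * (k * (k - 1)) + int a * k"
  by (rule theta_exp_int[of a "2 * h - a"]) (use assms in auto)

text \<open>The form $3j^2-2j+3k^2$ becomes $(6a^2-2a)+(6b^2-2b)$ under $(j,k)=(a+b,a-b)$, which covers
  the pairs with $j+k$ even, and $(6a^2-4a)+(6b^2-4b)+1$ under $(j,k)=(1-a-b,a-b)$, which covers those
  with $j+k$ odd.\<close>

lemma theta_product:
  "(theta 3 1 oo (-fps_X)) * theta 3 3 = theta 6 4 ^ 2 + fps_X * theta 6 2 ^ 2"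
proof -
  let ?e = "\<lambda>(j, k). theta_exp 3 1 j + theta_exp 3 3 k"
  let ?s = "\<lambda>(j, k). sign_pow k :: rat"
  have eint: "int (theta_exp 3 1 k) = 3 * (k * (k - 1)) + k"
     "int (theta_exp 3 3 k) = 3 * (k * (k - 1)) + 3 * k"
     "int (theta_exp 6 4 k) = 6 * (k * (k - 1)) + 4 * k"
     "int (theta_exp 6 2 k) = 6 * (k * (k - 1)) + 2 * k"
     "int (theta_exp 3 (Suc 0) k) = 3 * (k * (k - 1)) + k" for k
    by (simp_all add: theta_exp_int')
  have fin: "finite {k. theta_exp 3 1 k = n}" "finite {k. theta_exp 3 3 k = n}"
            "finite {k. theta_exp 6 4 k = n}" "finite {k. theta_exp 6 2 k = n}" for n
    by (simp_all add: finite_theta_exp')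
  have "theta 3 1 oo (-fps_X) = weight_gf (theta_exp 3 1) (\<lambda>_. 1)"
  proof (rule fps_ext)
    fix n
    \<comment> \<open>The exponent has the parity of \<open>k\<close>, as k(k-1) is even, so the
      sign from q to -q cancels \<open>sign_pow k\<close>.\<close>
    have "(- 1) ^ n * sign_pow k = (1 :: rat)" if "theta_exp 3 1 k = n" for k
    proof -
      have "even n \<longleftrightarrow> even (3 * (k * (k - 1)) + k)"
        using eint(1)[of k] that by (metis even_of_nat)
      thus ?thesis by (auto simp: sign_pow_def)
    qed
    thus "fps_nth (theta 3 1 oo (-fps_X)) n = fps_nth (weight_gf (theta_exp 3 1) (\<lambda>_. 1)) n"
      by (simp add: fps_compose_uminus' theta_def weight_gf_def sum_distrib_left)
  qed
  hence "(theta 3 1 oo (-fps_X)) * theta 3 3 = weight_gf ?e ?s"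
    by (simp only: theta_conv_weight_gf weight_gf_mult fin mult_1_left)
  also have "\<dots> = weight_gf (\<lambda>(a, b). theta_exp 6 4 a + theta_exp 6 4 b) (\<lambda>(a, b). sign_pow a * sign_pow b)
       + fps_X * weight_gf (\<lambda>(a, b). theta_exp 6 2 a + theta_exp 6 2 b) (\<lambda>(a, b). sign_pow a * sign_pow b)"
    (is "_ = ?G1 + _ * ?G2")
  proof (rule fps_ext)
    fix n
    let ?B = "{p. ?e p = n}"
    let ?even = "{p. even (fst p + snd p)}"
    have "finite {p. ?e p = n}"
      using finite_weight_fibre_pair[OF fin(1,2), of n] by (simp add: case_prod_unfold)
    hence "fps_nth (weight_gf ?e ?s) n = sum ?s (?B \<inter> ?even) + sum ?s (?B - ?even)"
      unfolding weight_gf_def fps_nth_Abs_fps by (rule sum.Int_Diff)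
    also have "sum ?s (?B \<inter> ?even) = fps_nth ?G1 n"
      unfolding weight_gf_def fps_nth_Abs_fps
    proof (rule sum.reindex_bij_witness[of _ "\<lambda>(a, b). (a + b, a - b)"
          "\<lambda>(j, k). ((j + k) div 2, (j - k) div 2)"], goal_cases)
      case (4 p)
      obtain a b where p: "p = (a, b)" by (cases p)
      have "int (?e (a + b, a - b)) = int (theta_exp 6 4 a + theta_exp 6 4 b)"
        by (simp add: eint algebra_simps)
      thus ?case using 4 p by simp
    next
      case (2 p)
      obtain j k where p: "p = (j, k)" by (cases p)
      have "even (j + k)" using 2 p by simp
      then obtain a where a: "j + k = 2 * a" by (elim evenE)
      have jk: "j = 2 * a - k" using a by simp
      have "int (theta_exp 6 4 a + theta_exp 6 4 (a - k)) = int (?e (j, k))"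
        unfolding jk by (simp add: eint algebra_simps)
      moreover have "(j - k) div 2 = a - k" "(j + k) div 2 = a" using jk by auto
      ultimately show ?case using 2 p by simp
    next
      \<comment> \<open>With \<open>b = a - k\<close>, the integers \<open>a + b\<close> and
        \<open>k\<close> have equal parity, so the sign splits over the new pair.\<close>
      case (5 p)
      obtain j k where p: "p = (j, k)" by (cases p)
      have "even (j + k)" using 5 p by simp
      then obtain a where a: "j + k = 2 * a" by (elim evenE)
      have jk: "j = 2 * a - k" using a by simp
      have "(j - k) div 2 = a - k" "(j + k) div 2 = a" using jk by auto
      thus ?case using p by (auto simp: sign_pow_def)
    next
      case (1 p)
      obtain j k where p: "p = (j, k)" by (cases p)
      have "even (j + k)" using 1 p by simp
      then obtain a where a: "j + k = 2 * a" by (elim evenE)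
      have jk: "j = 2 * a - k" using a by simp
      have "(j - k) div 2 = a - k" "(j + k) div 2 = a" using jk by auto
      thus ?case using p jk by simp
    qed (auto elim!: evenE)
    also have "sum ?s (?B - ?even) = fps_nth (fps_X * ?G2) n"
    proof -
      have "fps_nth (fps_X * ?G2) n
              = (\<Sum>p | (case p of (a, b) \<Rightarrow> Suc (theta_exp 6 2 a + theta_exp 6 2 b)) = n.
                   case p of (a, b) \<Rightarrow> sign_pow a * sign_pow b)"
        by (cases n) (auto simp: weight_gf_def case_prod_unfold)
      moreover have "sum ?s (?B - ?even) = \<dots>"
      proof (rule sum.reindex_bij_witness[of _ "\<lambda>(a, b). (1 - a - b, a - b)"
            "\<lambda>(j, k). ((1 - j + k) div 2, (1 - j - k) div 2)"], goal_cases)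
        case (4 p)
        obtain a b where p: "p = (a, b)" by (cases p)
        have "int (?e (1 - a - b, a - b)) = int (Suc (theta_exp 6 2 a + theta_exp 6 2 b))"
          by (simp add: eint algebra_simps)
        thus ?case using 4 p by auto
      next
        case (2 p)
        obtain j k where p: "p = (j, k)" by (cases p)
        have "even (1 - j + k)" using 2 p by simp
        then obtain a where a: "1 - j + k = 2 * a" by (elim evenE)
        have jk: "j = k + 1 - 2 * a" using a by simp
        have "int (Suc (theta_exp 6 2 a + theta_exp 6 2 (a - k))) = int (?e (j, k))"
          unfolding jk by (simp add: eint algebra_simps)
        moreover have "(1 - j - k) div 2 = a - k" "(1 - j + k) div 2 = a" using jk by auto
        ultimately show ?case using 2 p by simp
      next
        case (5 p)
        obtain j k where p: "p = (j, k)" by (cases p)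
        have "even (1 - j + k)" using 5 p by simp
        then obtain a where a: "1 - j + k = 2 * a" by (elim evenE)
        have jk: "j = k + 1 - 2 * a" using a by simp
        have "(1 - j - k) div 2 = a - k" "(1 - j + k) div 2 = a" using jk by auto
        thus ?case using p by (auto simp: sign_pow_def)
      next
        case (1 p)
        obtain j k where p: "p = (j, k)" by (cases p)
        have "even (1 - j + k)" using 1 p by simp
        then obtain a where a: "1 - j + k = 2 * a" by (elim evenE)
        have jk: "j = k + 1 - 2 * a" using a by simp
        have "(1 - j - k) div 2 = a - k" "(1 - j + k) div 2 = a" using jk by auto
        thus ?case using p jk by simp
      qed (auto elim!: oddE)
      ultimately show ?thesis by simp
    qed
    finally show "fps_nth (weight_gf ?e ?s) n = fps_nth (?G1 + fps_X * ?G2) n"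
      by simp
  qed
  also have "?G1 = theta 6 4 ^ 2"
    by (simp add: power2_eq_square theta_conv_weight_gf weight_gf_mult fin)
  also have "?G2 = theta 6 2 ^ 2"
    by (simp add: power2_eq_square theta_conv_weight_gf weight_gf_mult fin)
  finally show ?thesis .
qed

section \<open>Eta quotient identities\<close>

text \<open>Multiplying \<open>D\<close> by e4^3 e12 / (e2 e6^5) turns its two terms into
  \<open>s\<close> and \<open>q * r\<close>. Here \<open>te3\<close> stands for E(-q^3), and
  \<open>t31\<close>, \<open>t33\<close>, \<open>t62\<close> for theta series, the second taken at
  -q.\<close>

lemma eta_quotient_difference:
  fixes e1 e2 e3 e4 e6 e12 q s r t31 t33 t62 te3 :: "'a::field"
  assumes nz: "e1 \<noteq> 0" "e2 \<noteq> 0" "e3 \<noteq> 0" "e4 \<noteq> 0" "e6 \<noteq> 0" "e12 \<noteq> 0"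
    and "t31 * (e2 * e3) = e1 * e6 ^ 2" "t33 * e6 = te3 ^ 2" "t62 * (e4 * e6) = e2 * e12 ^ 2"
    and "te3 * e3 * e12 = e6 ^ 3"
    and D: "t31 * t33 = e4 ^ 2 - q * t62 ^ 2"
    and "s * (e2 * e6 ^ 5) = e4 ^ 5 * e12" "r * e6 ^ 7 = e2 * e4 * e12 ^ 5"
  shows "(s - q * r) * (e12 * e2 ^ 2 * e3 ^ 3) = e1 * e6 ^ 2 * e4 ^ 3"
proof -
  have 1: "t31 = e1 * e6 ^ 2 / (e2 * e3)" "t33 = te3 ^ 2 / e6" "t62 = e2 * e12 ^ 2 / (e4 * e6)"
    "te3 = e6 ^ 3 / (e3 * e12)" "s = e4 ^ 5 * e12 / (e2 * e6 ^ 5)" "r = e2 * e4 * e12 ^ 5 / e6 ^ 7"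
    using assms by (simp_all add: divide_simps mult_ac)
  have "s - q * r = (e4 ^ 3 * e12 / (e2 * e6 ^ 5)) * (e4 ^ 2 - q * t62 ^ 2)"
    unfolding 1 using nz by (simp add: divide_simps) (simp add: algebra_simps eval_nat_numeral)
  also have "\<dots> = e4 ^ 3 * e12 / (e2 * e6 ^ 5) * (t31 * t33)"
    unfolding D ..
  also have "\<dots> = e1 * e6 ^ 2 * e4 ^ 3 / (e12 * e2 ^ 2 * e3 ^ 3)"
    unfolding 1 using nz by (simp add: divide_simps) (simp add: algebra_simps eval_nat_numeral)
  finally show ?thesis using nz by simp
qed

text \<open>\<open>te1\<close> and \<open>te3\<close> stand for E(-q) and E(-q^3). Eliminating them
  makes \<open>w\<close> an ordinary eta quotient, from which both claims are read off.\<close>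

lemma eta_quotient_product:
  fixes e1 e2 e3 e4 e6 e12 s z w te1 te3 :: "'a::field"
  assumes nz: "e1 \<noteq> 0" "e2 \<noteq> 0" "e3 \<noteq> 0" "e4 \<noteq> 0" "e6 \<noteq> 0" "e12 \<noteq> 0" "te1 \<noteq> 0" "te3 \<noteq> 0"
    and "te1 * e1 * e4 = e2 ^ 3" "te3 * e3 * e12 = e6 ^ 3"
    and "s * (e2 * e6 ^ 5) = e4 ^ 5 * e12"
    and "z * (e12 * e2 ^ 2 * e3 ^ 3) = e1 * e6 ^ 2 * e4 ^ 3"
    and "w * (e12 * e2 ^ 2 * te3 ^ 3) = te1 * e6 ^ 2 * e4 ^ 3"
  shows "z * w = s"
    and "w ^ 5 = e2 ^ 5 * e4 ^ 10 * e12 ^ 10 * e3 ^ 15 / (e1 ^ 5 * e6 ^ 35)"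
proof -
  have 1: "s = e4 ^ 5 * e12 / (e2 * e6 ^ 5)" "z = e1 * e6 ^ 2 * e4 ^ 3 / (e12 * e2 ^ 2 * e3 ^ 3)"
    "w = te1 * e6 ^ 2 * e4 ^ 3 / (e12 * e2 ^ 2 * te3 ^ 3)"
    "te1 = e2 ^ 3 / (e1 * e4)" "te3 = e6 ^ 3 / (e3 * e12)"
    using assms by (simp_all add: divide_simps mult_ac)
  have 2: "w = e2 * e3 ^ 3 * e4 ^ 2 * e12 ^ 2 / (e1 * e6 ^ 7)"
    unfolding 1(3) unfolding 1(4,5) using nz
    by (simp add: divide_simps) (simp add: algebra_simps eval_nat_numeral)
  show "z * w = s"
    unfolding 1(1,2) 2 using nz by (simp add: divide_simps) (simp add: algebra_simps eval_nat_numeral)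
  show "w ^ 5 = e2 ^ 5 * e4 ^ 10 * e12 ^ 10 * e3 ^ 15 / (e1 ^ 5 * e6 ^ 35)"
    unfolding 2 by (simp add: power_divide power_mult_distrib mult_ac flip: power_mult)
qed

text \<open>\<open>x\<close> and \<open>r'\<close> are the values at q of the functions whose values
  at q^2 are \<open>s\<close> and \<open>r\<close>; \<open>rel\<close> is thus the relation
  \<open>prod\<close> one level down.\<close>

lemma hauptmodul_relation:
  fixes e1 e2 e3 e4 e6 e12 q s r r' x z :: "'a::field"
  assumes nz: "e1 \<noteq> 0" "e2 \<noteq> 0" "e3 \<noteq> 0" "e4 \<noteq> 0" "e6 \<noteq> 0" "e12 \<noteq> 0"
    and "s * (e2 * e6 ^ 5) = e4 ^ 5 * e12" "r * e6 ^ 7 = e2 * e4 * e12 ^ 5"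
    and "x * (e1 * e3 ^ 5) = e2 ^ 5 * e6" "r' * e3 ^ 7 = e1 * e2 * e6 ^ 5"
    and z: "z * (e12 * e2 ^ 2 * e3 ^ 3) = e1 * e6 ^ 2 * e4 ^ 3"
    and diff: "z = s - q * r"
    and prod: "z * (s + q * r) = s"
    and rel: "x ^ 2 - q * r' ^ 2 = x"
  shows "x = 3 * z - 2 * z ^ 2"
proof -
  have 1: "s = e4 ^ 5 * e12 / (e2 * e6 ^ 5)" "r = e2 * e4 * e12 ^ 5 / e6 ^ 7"
    "x = e2 ^ 5 * e6 / (e1 * e3 ^ 5)" "r' = e1 * e2 * e6 ^ 5 / e3 ^ 7"
    "z = e1 * e6 ^ 2 * e4 ^ 3 / (e12 * e2 ^ 2 * e3 ^ 3)"
    using assms by (simp_all add: divide_simps mult_ac)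
  have nz': "s \<noteq> 0" "x \<noteq> 0" using nz by (simp_all add: 1)
  have "x * (x - 1) = q * r' ^ 2" using rel by (simp add: algebra_simps power2_eq_square)
  hence "x - 1 = q * (r' ^ 2 / x)" using nz' by (simp add: field_simps)
  \<comment> \<open>Both sides equal e1^3 e6^9 / (e2^3 e3^9). This coincidence links the functions
    of q to those of q^2.\<close>
  also have "r' ^ 2 / x = r * z ^ 3 / s ^ 2"
    unfolding 1 using nz by (simp add: divide_simps) (simp add: algebra_simps eval_nat_numeral)
  finally have "s ^ 2 * (x - 1) = (q * r) * z ^ 3" using nz' by simp
  also have "q * r = s - z" using diff by simp
  also have "(s - z) * z ^ 3 = s ^ 2 * (1 - z) * (2 * z - 1)"
  proof -
    have "s + q * r = 2 * s - z" using diff by simp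
    hence "z * (2 * s - z) = s" using prod by simp
    \<comment> \<open>A quadratic equation for \<open>z\<close> over \<open>s\<close>: each use
      trades a square of \<open>z\<close> for a factor \<open>s\<close>, until \<open>s ^ 2\<close>
      can be cancelled.\<close>
    hence zz: "z ^ 2 = s * (2 * z - 1)" by (simp add: algebra_simps power2_eq_square)
    have "(s - z) * z ^ 3 = z ^ 2 * (s * z - z ^ 2)"
      by (simp add: algebra_simps power2_eq_square power3_eq_cube)
    also have "\<dots> = z ^ 2 * (s * z - s * (2 * z - 1))" by (simp only: zz)
    also have "\<dots> = s * (1 - z) * z ^ 2" by (simp add: algebra_simps)
    also have "\<dots> = s ^ 2 * (1 - z) * (2 * z - 1)"
      by (simp only: zz) (simp add: algebra_simps power2_eq_square)
    finally show ?thesis .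
  qed
  finally have "x - 1 = (1 - z) * (2 * z - 1)" using nz' by (simp add: mult.assoc)
  thus ?thesis by (simp add: algebra_simps power2_eq_square)
qed

text \<open>Chosen so that o = q rho(q^2); keeping it undilated lets relations in q^2 be read back
  in q.\<close>

definition rho_fps :: "rat fps" where
  "rho_fps = Eq 1 * Eq 2 * Eq 6 ^ 5 * inverse (Eq 3 ^ 7)"

lemma fps_dil_hom:
  assumes "k > 0"
  shows "fps_dil k (f * g) = fps_dil k f * fps_dil k g"
    and "fps_dil k (f + g) = fps_dil k f + fps_dil k g"
    and "fps_dil k (f - g) = fps_dil k f - fps_dil k g"
    and "fps_dil k (f ^ n) = fps_dil k f ^ n"
    and "fps_dil k fps_X = fps_X ^ k"
    and "fps_dil k (of_int c) = of_int c"
  using assms by (simp_all add: fps_dil_conv_compose fps_compose_mult_distrib fps_compose_add_distrib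
      fps_compose_sub_distrib fps_compose_power flip: fps_of_int)

lemma fps_dil_Eq: "k > 0 \<Longrightarrow> d > 0 \<Longrightarrow> fps_dil k (Eq d) = Eq (k * d)"
  by (auto simp: fps_eq_iff Eq_def fps_dil_def div_mult2_eq)

lemma fps_dil_uminus: "fps_dil 2 f oo (-fps_X) = fps_dil 2 f"
  by (auto simp: fps_eq_iff fps_dil_def fps_compose_uminus')

lemma fps_dil_inject: "k > 0 \<Longrightarrow> fps_dil k f = fps_dil k g \<longleftrightarrow> f = g"
proof
  assume k: "k > 0" and eq: "fps_dil k f = fps_dil k g"
  show "f = g"
  proof (rule fps_ext)
    fix n
    from eq have "fps_nth (fps_dil k f) (k * n) = fps_nth (fps_dil k g) (k * n)" by simp
    thus "fps_nth f n = fps_nth g n" using k by (simp add: fps_dil_def)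
  qed
qed auto

lemma U_op_dil_add_odd: "U_op (fps_dil 2 f + fps_X * fps_dil 2 g) = f"
  by (auto simp: fps_eq_iff U_op_def fps_dil_def)

lemma xi_mult: "xi_fps * (Eq 1 * Eq 3 ^ 5) = Eq 2 ^ 5 * Eq 6"
  unfolding xi_fps_def mult.assoc by (subst inverse_mult_eq_1) (simp_all add: Eq_nth_0 fps_power_zeroth)

lemma rho_mult: "rho_fps * Eq 3 ^ 7 = Eq 1 * Eq 2 * Eq 6 ^ 5"
  unfolding rho_fps_def mult.assoc by (subst inverse_mult_eq_1) (simp_all add: Eq_nth_0 fps_power_zeroth)

text \<open>Both series are defined by their dissections, which makes q to -q exchange them at once;
  the product forms are then proved in \<open>z_mult\<close> and \<open>w_mult\<close>.\<close>

definition w_fps :: "rat fps" where "w_fps = fps_dil 2 xi_fps + fps_X * fps_dil 2 rho_fps"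
definition z_fps :: "rat fps" where "z_fps = fps_dil 2 xi_fps - fps_X * fps_dil 2 rho_fps"

lemma dil_xi_mult: "fps_dil 2 xi_fps * (Eq 2 * Eq 6 ^ 5) = Eq 4 ^ 5 * Eq 12"
  using arg_cong[OF xi_mult, of "fps_dil 2"] by (simp add: fps_dil_hom fps_dil_Eq)

lemma dil_rho_mult: "fps_dil 2 rho_fps * Eq 6 ^ 7 = Eq 2 * Eq 4 * Eq 12 ^ 5"
  using arg_cong[OF rho_mult, of "fps_dil 2"] by (simp add: fps_dil_hom fps_dil_Eq)

lemma Eq_nonzero: "d > 0 \<Longrightarrow> Eq d \<noteq> 0"
  using Eq_nth_0[of d] by force

lemma Eq_even_uminus: "even d \<Longrightarrow> d > 0 \<Longrightarrow> Eq d oo (-fps_X) = Eq d"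
  using fps_dil_uminus[of "Eq (d div 2)"] fps_dil_Eq[of 2 "d div 2"] by (auto elim!: evenE)

lemmas tw_simps = fps_compose_mult_distrib fps_compose_add_distrib
      fps_compose_sub_distrib fps_compose_power [symmetric] fps_dil_uminus Eq_even_uminus

text \<open>The dissection is proved for \<open>z_fps\<close> first: replacing q by -q in
  \<open>theta_product\<close> leaves \<open>theta 3 1\<close> untwisted, and only E(-q^3) enters,
  through \<open>theta 3 3\<close>.\<close>

lemma z_mult: "z_fps * (Eq 12 * Eq 2 ^ 2 * Eq 3 ^ 3) = Eq 1 * Eq 6 ^ 2 * Eq 4 ^ 3"
proof -
  have t33: "(theta 3 3 oo (-fps_X)) * Eq 6 = (Eq 3 oo (-fps_X)) ^ 2"
    using arg_cong[OF theta_1_2[of 3], of "\<lambda>f. f oo (-fps_X)"] by (simp add: tw_simps)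
  have inv: "(f oo (-fps_X)) oo (-fps_X) = f" for f :: "rat fps"
    by (simp add: fps_eq_iff fps_compose_uminus' flip: mult.assoc power_mult_distrib)
  have t64: "theta 6 4 = Eq 4" using theta_1_3[of 4] by simp
  have t62: "theta 6 2 * (Eq 4 * Eq 6) = Eq 2 * Eq 12 ^ 2" using theta_1_6[of 2] by simp
  \<comment> \<open>Evenness is read off the product evaluation, which involves only Euler products
    in q^2 and can be cancelled.\<close>
  have t62': "theta 6 2 oo (-fps_X) = theta 6 2"
  proof -
    have "(theta 6 2 oo (-fps_X)) * (Eq 4 * Eq 6) = Eq 2 * Eq 12 ^ 2"
      using arg_cong[OF t62, of "\<lambda>f. f oo (-fps_X)"] by (simp add: tw_simps)
    hence "(theta 6 2 oo (-fps_X)) * (Eq 4 * Eq 6) = theta 6 2 * (Eq 4 * Eq 6)"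
      by (simp add: t62)
    thus ?thesis by (simp add: Eq_nonzero)
  qed
  have D: "theta 3 1 * (theta 3 3 oo (-fps_X)) = Eq 4 ^ 2 - fps_X * theta 6 2 ^ 2"
    using arg_cong[OF theta_product, of "\<lambda>f. f oo (-fps_X)"]
    by (simp add: tw_simps inv t64 t62')
  have "fps_to_fls (z_fps * (Eq 12 * Eq 2 ^ 2 * Eq 3 ^ 3)) = fps_to_fls (Eq 1 * Eq 6 ^ 2 * Eq 4 ^ 3)"
    using theta_1_6[of 1, THEN arg_cong, of fps_to_fls] t33[THEN arg_cong, of fps_to_fls]
      t62[THEN arg_cong, of fps_to_fls] Eq_uminus[of 3, THEN arg_cong, of fps_to_fls]
      D[THEN arg_cong, of fps_to_fls] dil_xi_mult[THEN arg_cong, of fps_to_fls]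
      dil_rho_mult[THEN arg_cong, of fps_to_fls]
    unfolding z_fps_def fls_times_fps_to_fls fps_to_fls_power fps_to_fls_minus
    by (intro eta_quotient_difference[where ?t31.0 = "fps_to_fls (theta 3 1)" and ?t33.0 = "fps_to_fls (theta 3 3 oo (-fps_X))"
          and ?t62.0 = "fps_to_fls (theta 6 2)" and ?te3.0 = "fps_to_fls (Eq 3 oo (-fps_X))"])
       (simp_all add: Eq_nonzero fls_times_fps_to_fls fps_to_fls_power)
  thus ?thesis by simp
qed

lemma Eq_uminus_nonzero: "odd d \<Longrightarrow> Eq d oo (-fps_X) \<noteq> 0"
  using Eq_uminus[of d] Eq_nonzero[of "2 * d"] by (auto simp: odd_pos)

lemma w_mult: "w_fps * (Eq 12 * Eq 2 ^ 2 * (Eq 3 oo (-fps_X)) ^ 3) = (Eq 1 oo (-fps_X)) * Eq 6 ^ 2 * Eq 4 ^ 3"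
proof -
  have "z_fps oo (-fps_X) = w_fps"
    by (simp add: z_fps_def w_fps_def tw_simps)
  thus ?thesis
    using arg_cong[OF z_mult, of "\<lambda>f. f oo (-fps_X)"] by (simp add: tw_simps)
qed

lemma z_w_eq: "z_fps * w_fps = fps_dil 2 xi_fps"
proof -
  have "fps_to_fls z_fps * fps_to_fls w_fps = fps_to_fls (fps_dil 2 xi_fps)"
    using Eq_uminus[of 1, THEN arg_cong, of fps_to_fls] Eq_uminus[of 3, THEN arg_cong, of fps_to_fls]
      dil_xi_mult[THEN arg_cong, of fps_to_fls] z_mult[THEN arg_cong, of fps_to_fls]
      w_mult[THEN arg_cong, of fps_to_fls] Eq_uminus_nonzero[of 1] Eq_uminus_nonzero[of 3]
    by (intro eta_quotient_product(1)[where z = "fps_to_fls z_fps" and w = "fps_to_fls w_fps" and s = "fps_to_fls (fps_dil 2 xi_fps)"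
          and ?e1.0 = "fps_to_fls (Eq 1)" and ?e2.0 = "fps_to_fls (Eq 2)"
          and ?e3.0 = "fps_to_fls (Eq 3)" and ?e4.0 = "fps_to_fls (Eq 4)" and ?e6.0 = "fps_to_fls (Eq 6)"
          and ?e12.0 = "fps_to_fls (Eq 12)" and ?te1.0 = "fps_to_fls (Eq 1 oo (-fps_X))"
          and ?te3.0 = "fps_to_fls (Eq 3 oo (-fps_X))"])
       (simp_all add: Eq_nonzero fls_times_fps_to_fls fps_to_fls_power)
  thus ?thesis by (simp only: fls_times_fps_to_fls [symmetric] fps_to_fls_eq_iff)
qed

text \<open>Inverses of power series and of Laurent series are comparable here because a nonzero
  constant term makes the power series a unit.\<close>

lemma fps_to_fls_inverse:
  "fps_nth f 0 \<noteq> 0 \<Longrightarrow> fps_to_fls (inverse f) = inverse (fps_to_fls f :: 'a::field fls)"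
  by (simp add: fls_inverse_fps_to_fls subdegree_eq_0)

lemma kappa_eq: "kappa_fps = w_fps ^ 5"
proof -
  have "fps_to_fls w_fps ^ 5 = fps_to_fls (Eq 2) ^ 5 * fps_to_fls (Eq 4) ^ 10 * fps_to_fls (Eq 12) ^ 10
         * fps_to_fls (Eq 3) ^ 15 / (fps_to_fls (Eq 1) ^ 5 * fps_to_fls (Eq 6) ^ 35)"
    using Eq_uminus[of 1, THEN arg_cong, of fps_to_fls] Eq_uminus[of 3, THEN arg_cong, of fps_to_fls]
      dil_xi_mult[THEN arg_cong, of fps_to_fls] z_mult[THEN arg_cong, of fps_to_fls]
      w_mult[THEN arg_cong, of fps_to_fls] Eq_uminus_nonzero[of 1] Eq_uminus_nonzero[of 3]
    by (intro eta_quotient_product(2)[where z = "fps_to_fls z_fps" and s = "fps_to_fls (fps_dil 2 xi_fps)"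
          and ?e1.0 = "fps_to_fls (Eq 1)" and ?e2.0 = "fps_to_fls (Eq 2)"
          and ?e3.0 = "fps_to_fls (Eq 3)" and ?e4.0 = "fps_to_fls (Eq 4)" and ?e6.0 = "fps_to_fls (Eq 6)"
          and ?e12.0 = "fps_to_fls (Eq 12)" and ?te1.0 = "fps_to_fls (Eq 1 oo (-fps_X))"
          and ?te3.0 = "fps_to_fls (Eq 3 oo (-fps_X))"])
       (simp_all add: Eq_nonzero fls_times_fps_to_fls fps_to_fls_power)
  also have "\<dots> = fps_to_fls kappa_fps"
    using Eq_nonzero[of 1] Eq_nonzero[of 2] Eq_nonzero[of 3] Eq_nonzero[of 4] Eq_nonzero[of 6] Eq_nonzero[of 12]
    by (simp add: kappa_fps_def gamma_at_def fls_times_fps_to_fls fps_to_fls_power fps_to_fls_inverse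
        Eq_nth_0 fps_power_zeroth fps_inverse_mult fps_inverse_power)
       (simp add: divide_simps; simp add: algebra_simps eval_nat_numeral)
  finally show ?thesis by (simp flip: fps_to_fls_power)
qed

text \<open>The passage from q^2 to q: z w = s^2 - o^2 is itself a dilation, and dilation is
  injective.\<close>

lemma xi_quadratic: "xi_fps ^ 2 - fps_X * rho_fps ^ 2 = xi_fps"
proof -
  have "fps_dil 2 (xi_fps ^ 2 - fps_X * rho_fps ^ 2) = z_fps * w_fps"
    by (simp add: fps_dil_hom z_fps_def w_fps_def algebra_simps power2_eq_square)
  thus ?thesis by (simp add: z_w_eq fps_dil_inject)
qed

lemma xi_eq: "xi_fps = 3 * z_fps - 2 * z_fps ^ 2"
proof -
  have "fps_to_fls xi_fps = 3 * fps_to_fls z_fps - 2 * fps_to_fls z_fps ^ 2"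
    using dil_xi_mult[THEN arg_cong, of fps_to_fls] dil_rho_mult[THEN arg_cong, of fps_to_fls]
      xi_mult[THEN arg_cong, of fps_to_fls] rho_mult[THEN arg_cong, of fps_to_fls]
      z_mult[THEN arg_cong, of fps_to_fls]
      z_w_eq[THEN arg_cong, of fps_to_fls] xi_quadratic[THEN arg_cong, of fps_to_fls]
    unfolding z_fps_def w_fps_def
    by (intro hauptmodul_relation[where ?e1.0 = "fps_to_fls (Eq 1)" and ?e2.0 = "fps_to_fls (Eq 2)"
          and ?e3.0 = "fps_to_fls (Eq 3)" and ?e4.0 = "fps_to_fls (Eq 4)" and ?e6.0 = "fps_to_fls (Eq 6)"
          and ?e12.0 = "fps_to_fls (Eq 12)" and s = "fps_to_fls (fps_dil 2 xi_fps)"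
          and r = "fps_to_fls (fps_dil 2 rho_fps)" and r' = "fps_to_fls rho_fps" and q = "fps_to_fls fps_X"])
       (simp_all add: Eq_nonzero fls_times_fps_to_fls fps_to_fls_power)
  also have "\<dots> = fps_to_fls (3 * z_fps - 2 * z_fps ^ 2)"
    by (simp add: fls_times_fps_to_fls fps_to_fls_power)
  finally show ?thesis by (simp only: fps_to_fls_eq_iff)
qed

section \<open>The ring generated by the level 12 functions\<close>

definition int_polys_in :: "'a::comm_ring_1 \<Rightarrow> 'a set" where
  "int_polys_in x = range (\<lambda>p :: int poly. poly (map_poly of_int p) x)"

lemma map_poly_of_int_add:
  "map_poly of_int (p + q) = map_poly of_int p + (map_poly of_int q :: 'a::comm_ring_1 poly)"
  by (simp add: poly_eq_iff coeff_map_poly)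

lemma map_poly_of_int_mult:
  "map_poly of_int (p * q) = map_poly of_int p * (map_poly of_int q :: 'a::comm_ring_1 poly)"
  by (simp add: poly_eq_iff coeff_map_poly coeff_mult)

lemma int_polys_in_add: "a \<in> int_polys_in x \<Longrightarrow> b \<in> int_polys_in x \<Longrightarrow> a + b \<in> int_polys_in x"
  unfolding int_polys_in_def by (auto simp flip: map_poly_of_int_add poly_add)

lemma int_polys_in_mult: "a \<in> int_polys_in x \<Longrightarrow> b \<in> int_polys_in x \<Longrightarrow> a * b \<in> int_polys_in x"
  unfolding int_polys_in_def by (auto simp flip: map_poly_of_int_mult poly_mult)

lemma int_polys_in_of_int: "of_int c \<in> int_polys_in x"
  unfolding int_polys_in_def by (rule range_eqI[of _ _ "[:c:]"]) (simp add: map_poly_pCons)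

lemma int_polys_in_self: "x \<in> int_polys_in x"
  unfolding int_polys_in_def by (rule range_eqI[of _ _ "[:0, 1:]"]) (simp add: map_poly_pCons)

text \<open>The module over Z[s] generated by 1 and o. It is closed under products because o^2 = s^2
  - s, and U simply returns the coefficient of 1 with s replaced by \<open>xi_fps\<close>.\<close>

definition level12_ring :: "rat fps set" where
  "level12_ring = {fps_dil 2 a + fps_X * fps_dil 2 (b * rho_fps) |a b.
     a \<in> int_polys_in xi_fps \<and> b \<in> int_polys_in xi_fps}"

lemma level12_ringI:
  "f = fps_dil 2 a + fps_X * fps_dil 2 (b * rho_fps) \<Longrightarrow> a \<in> int_polys_in xi_fps \<Longrightarrow>
     b \<in> int_polys_in xi_fps \<Longrightarrow> f \<in> level12_ring"
  unfolding level12_ring_def by blast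

lemma level12_ring_add:
  assumes "f \<in> level12_ring" "g \<in> level12_ring"
  shows "f + g \<in> level12_ring"
proof -
  from assms obtain a b c d where f: "f = fps_dil 2 a + fps_X * fps_dil 2 (b * rho_fps)"
    and g: "g = fps_dil 2 c + fps_X * fps_dil 2 (d * rho_fps)"
    and m: "a \<in> int_polys_in xi_fps" "b \<in> int_polys_in xi_fps"
      "c \<in> int_polys_in xi_fps" "d \<in> int_polys_in xi_fps"
    unfolding level12_ring_def by blast
  have "f + g = fps_dil 2 (a + c) + fps_X * fps_dil 2 ((b + d) * rho_fps)"
    by (simp add: f g fps_dil_hom algebra_simps)
  thus ?thesis by (rule level12_ringI) (intro int_polys_in_add m)+
qed

lemma level12_ring_mult:
  assumes "f \<in> level12_ring" "g \<in> level12_ring"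
  shows "f * g \<in> level12_ring"
proof -
  from assms obtain a b c d where f: "f = fps_dil 2 a + fps_X * fps_dil 2 (b * rho_fps)"
    and g: "g = fps_dil 2 c + fps_X * fps_dil 2 (d * rho_fps)"
    and m: "a \<in> int_polys_in xi_fps" "b \<in> int_polys_in xi_fps"
      "c \<in> int_polys_in xi_fps" "d \<in> int_polys_in xi_fps"
    unfolding level12_ring_def by blast
  \<comment> \<open>The product of the odd parts is even: \<open>fps_X * fps_X\<close> is the
    dilation of \<open>fps_X\<close>, which produces \<open>fps_X * rho_fps ^ 2\<close>. By
    \<open>xi_quadratic\<close> this is again an integer polynomial in
    \<open>xi_fps\<close>.\<close>
  have "f * g = fps_dil 2 (a * c + b * d * (fps_X * rho_fps ^ 2)) + fps_X * fps_dil 2 ((a * d + b * c) * rho_fps)"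
    by (simp add: f g fps_dil_hom algebra_simps power2_eq_square)
  also have "fps_X * rho_fps ^ 2 = xi_fps * xi_fps + of_int (-1) * xi_fps"
    using xi_quadratic by (simp add: algebra_simps power2_eq_square)
  finally have "f * g = fps_dil 2 (a * c + b * d * (xi_fps * xi_fps + of_int (-1) * xi_fps)) +
    fps_X * fps_dil 2 ((a * d + b * c) * rho_fps)" .
  moreover have "a * c + b * d * (xi_fps * xi_fps + of_int (-1) * xi_fps) \<in> int_polys_in xi_fps"
    by (intro int_polys_in_add int_polys_in_mult int_polys_in_self int_polys_in_of_int m)
  moreover have "a * d + b * c \<in> int_polys_in xi_fps"
    by (intro int_polys_in_add int_polys_in_mult m)
  ultimately show ?thesis by (rule level12_ringI)
qed

lemma level12_ring_of_int: "of_int c \<in> level12_ring"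
proof -
  have "of_int c = fps_dil 2 (of_int c) + fps_X * fps_dil 2 (of_int 0 * rho_fps)"
    using fps_dil_hom(6)[of 2 c] fps_dil_hom(6)[of 2 0] by simp
  thus ?thesis by (rule level12_ringI) (rule int_polys_in_of_int)+
qed

lemma level12_ring_power: "f \<in> level12_ring \<Longrightarrow> f ^ n \<in> level12_ring"
  using level12_ring_of_int[of 1] by (induction n) (auto intro: level12_ring_mult)

lemma w_in_level12_ring: "w_fps \<in> level12_ring" and z_in_level12_ring: "z_fps \<in> level12_ring"
proof -
  have "w_fps = fps_dil 2 xi_fps + fps_X * fps_dil 2 (of_int 1 * rho_fps)"
    by (simp add: w_fps_def)
  thus "w_fps \<in> level12_ring"
    by (rule level12_ringI) (intro int_polys_in_of_int int_polys_in_self)+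
  have "z_fps = fps_dil 2 xi_fps + fps_X * fps_dil 2 (of_int (-1) * rho_fps)"
    using fps_dil_hom(1)[of 2 "of_int (-1)" rho_fps] fps_dil_hom(6)[of 2 "-1"] by (simp add: z_fps_def)
  thus "z_fps \<in> level12_ring"
    by (rule level12_ringI) (intro int_polys_in_of_int int_polys_in_self)+
qed

lemma U_op_level12_ring: "f \<in> level12_ring \<Longrightarrow> U_op f \<in> int_polys_in xi_fps"
  unfolding level12_ring_def by (auto simp: U_op_dil_add_odd)

theorem theorem2p2:
  fixes i j :: nat
  shows "\<exists>p :: int poly.
           U_op (kappa_fps ^ i * xi_fps ^ j)
             = poly (map_poly (\<lambda>c. fps_const (of_int c)) p) xi_fps"
proof -
  have "of_int 3 * z_fps + of_int (-2) * z_fps ^ 2 \<in> level12_ring"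
    by (intro level12_ring_add level12_ring_mult level12_ring_power level12_ring_of_int z_in_level12_ring)
  also have "of_int 3 * z_fps + of_int (-2) * z_fps ^ 2 = xi_fps"
    by (simp add: xi_eq)
  finally have "xi_fps \<in> level12_ring" .
  hence "U_op (kappa_fps ^ i * xi_fps ^ j) \<in> int_polys_in xi_fps"
    unfolding kappa_eq
    by (intro U_op_level12_ring level12_ring_mult level12_ring_power w_in_level12_ring)
  thus ?thesis
    unfolding int_polys_in_def fps_of_int by blast
qed

end
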